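(* Let $\alpha\in(0,1)$, $\tau,h>0$, and let $f=f^++f^-$ with $f^\pm:\mathbb{R}\to\mathbb{R}$ continuously differentiable, $(f^+)'\ge 0$ and $(f^-)'\le 0$. Let $(U_j^n)_{j\in\mathbb{Z},n\ge 0}$ be a real solution of the first order explicit upwind scheme, i.e. for all $j\in\mathbb{Z}$, $n\ge 0$, $$D_t^\alpha U_j^{n+1}+\frac1h\big(f^+(U_j^n)-f^+(U_{j-1}^n)\big)+\frac1h\big(f^-(U_{j+1}^n)-f^-(U_j^n)\big)=0.$$ Let $I\subseteq\mathbb{R}$ be an interval containing all the initial values $U_j^0$ ($j\in\mathbb{Z}$), and suppose that the CFL condition $$\frac{\tau^\alpha}{h\,\Gamma(2-\alpha)}\Big(\sup_{I}|(f^+)'|+\sup_{I}|(f^-)'|\Big)\le \tilde c,\qquad \tilde c:=2-2^{1-\alpha},$$ holds. Then the scheme is TVD: for all $n\ge 1$, $\mathrm{TV}[U^n]\le \mathrm{TV}[U^0]$, where $\mathrm{TV}[U^n]=\sum_{j\in\mathbb{Z}}|U_{j+1}^n-U_j^n|$.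
   Context: The scheme approximates the conservation law $\partial_t^\alpha u+(f(u))_x=0$ with Caputo derivative $\partial_t^\alpha$, on a uniform grid with time step $\tau$ and mesh size $h$. The discrete Caputo derivative is $$D_t^\alpha U_j^{n+1}=\frac{1}{\Gamma(2-\alpha)\tau^\alpha}\Big(U_j^{n+1}-\sum_{k=0}^n c_k^{n+1}U_j^k\Big),\qquad n\ge 0,$$ with $c_0^{n+1}=(n+1)^{1-\alpha}-n^{1-\alpha}$ and $c_k^{n+1}=2(n+1-k)^{1-\alpha}-(n+2-k)^{1-\alpha}-(n-k)^{1-\alpha}$ for $1\le k\le n$ (with $0^{1-\alpha}=0$). Sums of nonnegative terms are taken in $[0,\infty]$. *)

theory Defs
  imports "HOL-Analysis.Analysis"
begin

(* caputo_coeff \<alpha> n k is c_k^{n+1}, for k \<le> n.  The convention 0^{1-\<alpha>} = 0 is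
   built into powr. *)
definition caputo_coeff :: "real \<Rightarrow> nat \<Rightarrow> nat \<Rightarrow> real" where
  "caputo_coeff \<alpha> n k =
     (if k = 0 then (real n + 1) powr (1 - \<alpha>) - real n powr (1 - \<alpha>)
      else 2 * (real n + 1 - real k) powr (1 - \<alpha>)
           - (real n + 2 - real k) powr (1 - \<alpha>)
           - (real n - real k) powr (1 - \<alpha>))"

(* The value at time level n + 1, for a grid function u of time only. *)
definition discrete_caputo :: "real \<Rightarrow> real \<Rightarrow> (nat \<Rightarrow> real) \<Rightarrow> nat \<Rightarrow> real" where
  "discrete_caputo \<alpha> \<tau> u n =
     1 / (Gamma (2 - \<alpha>) * \<tau> powr \<alpha>) * (u (n + 1) - (\<Sum>k=0..n. caputo_coeff \<alpha> n k * u k))"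

(* Time index first: U n j is U_j^n. *)
definition upwind_solution ::
  "real \<Rightarrow> real \<Rightarrow> real \<Rightarrow> (real \<Rightarrow> real) \<Rightarrow> (real \<Rightarrow> real) \<Rightarrow> (nat \<Rightarrow> int \<Rightarrow> real) \<Rightarrow> bool" where
  "upwind_solution \<alpha> \<tau> h fp fm U \<longleftrightarrow>
     (\<forall>j n. discrete_caputo \<alpha> \<tau> (\<lambda>m. U m j) n
            + 1 / h * (fp (U n j) - fp (U n (j - 1)))
            + 1 / h * (fm (U n (j + 1)) - fm (U n j)) = 0)"

(* Suprema are taken in [0,\<infinity>], so the condition fails if a derivative is unbounded on I
   (a real-valued Sup would be unspecified there). *)
definition cfl_condition ::
  "real \<Rightarrow> real \<Rightarrow> real \<Rightarrow> (real \<Rightarrow> real) \<Rightarrow> (real \<Rightarrow> real) \<Rightarrow> real set \<Rightarrow> bool" where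
  "cfl_condition \<alpha> \<tau> h fp fm I \<longleftrightarrow>
     ennreal (\<tau> powr \<alpha> / (h * Gamma (2 - \<alpha>)))
       * ((SUP x\<in>I. ennreal \<bar>deriv fp x\<bar>) + (SUP x\<in>I. ennreal \<bar>deriv fm x\<bar>))
     \<le> ennreal (2 - 2 powr (1 - \<alpha>))"

definition total_variation :: "(int \<Rightarrow> real) \<Rightarrow> ennreal" where
  "total_variation v = (\<Sum>\<^sub>\<infinity>j\<in>UNIV. ennreal \<bar>v (j + 1) - v j\<bar>)"

end

theory Submission imports Defs begin

text \<open>
  Solving the scheme for \<open>U\<^sup>n\<^sup>+\<^sup>1\<close> gives \<open>\<Sum>k<n. c\<^sub>k U\<^sup>k\<close> plus one upwind step applied to
  \<open>c\<^sub>n U\<^sup>n\<close>, where the \<open>c\<^sub>k\<close> are nonnegative (concavity of \<open>x\<^sup>1\<^sup>-\<^sup>\<alpha>\<close>) and telescope to 1.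
  As \<open>c\<^sub>n \<ge> 2 - 2\<^sup>1\<^sup>-\<^sup>\<alpha>\<close> and \<open>\<Gamma>(2 - \<alpha>) \<le> 1 \<le> 1 / \<Gamma>(2 - \<alpha>)\<close>, the CFL condition makes the upwind
  step monotone, as long as all values stay in the interval where it bounds the derivatives.
  They do, since each new value is then a convex combination of old ones.  Harten's argument
  bounds the variation of the upwind step by \<open>c\<^sub>n TV[U\<^sup>n]\<close>, and induction on \<open>n\<close> finishes the proof.
\<close>

section \<open>Nonnegativity, sum and size of the Caputo coefficients\<close>

text \<open>By the mean value theorem both first differences are values of
  \<open>b * t powr (b - 1)\<close>, which is nonincreasing in \<open>t\<close> as
  \<open>b \<le> 1\<close>.\<close>

lemma powr_midpoint_concave:
  fixes b x :: real
  assumes "0 < b" "b \<le> 1" "0 \<le> x"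
  shows "(x + 2) powr b + x powr b \<le> 2 * (x + 1) powr b"
proof -
  have cont: "continuous_on {y..z} (\<lambda>t. t powr b)" if "0 \<le> y" for y z :: real
    using that assms by (intro continuous_on_powr' continuous_intros) auto
  have der: "((\<lambda>t. t powr b) has_real_derivative b * t powr (b - 1)) (at t)" if "0 < t" for t
    using that by (auto intro!: derivative_eq_intros)
  \<comment> \<open>At \<open>x = 0\<close> the power need not be differentiable, so this interval
    takes the version of the theorem that asks only for continuity at the endpoints.\<close>
  obtain s where s: "x < s" "s < x + 1" "(x + 1) powr b - x powr b = (x + 1 - x) * (b * s powr (b - 1))"
    using mvt[OF _ cont, of x "x + 1" "\<lambda>t. (*) (b * t powr (b - 1))"] der assms
    by (auto simp: has_field_derivative_def mult.commute)
  obtain t where t: "x + 1 < t" "t < x + 2" "(x + 2) powr b - (x + 1) powr b = (x + 2 - (x + 1)) * (b * t powr (b - 1))"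
    using der assms MVT2[of "x + 1" "x+2" "\<lambda>t. t powr b" "\<lambda>t. b * t powr (b - 1)"] by auto
  have "t powr (b - 1) \<le> s powr (b - 1)"
    using s t assms by (intro powr_mono2') auto
  then have "b * t powr (b - 1) \<le> b * s powr (b - 1)"
    using assms by (intro mult_left_mono) auto
  then show ?thesis
    using s(3) t(3) by (simp add: algebra_simps)
qed

lemma caputo_coeff_nonneg:
  assumes "0 < \<alpha>" "\<alpha> < 1" "k \<le> n"
  shows "0 \<le> caputo_coeff \<alpha> n k"
proof (cases "k = 0")
  case True
  then show ?thesis
    using powr_mono2[of "1 - \<alpha>" "real n" "real n + 1"] assms by (simp add: caputo_coeff_def)
next
  case False
  then show ?thesis
    using powr_midpoint_concave[of "1 - \<alpha>" "real n - real k"] assms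
    by (simp add: caputo_coeff_def algebra_simps)
qed

lemma sum_caputo_coeff:
  assumes "\<alpha> < 1"
  shows "(\<Sum>k=0..n. caputo_coeff \<alpha> n k) = 1"
proof -
  \<comment> \<open>For \<open>k > 0\<close> the coefficient is \<open>d k - d (k - 1)\<close>, so
    the sum telescopes to \<open>d n\<close>, which is 1 because
    \<open>0 powr (1 - \<alpha>) = 0\<close>.\<close>
  define d where "d k = (real n + 1 - real k) powr (1 - \<alpha>) - (real n - real k) powr (1 - \<alpha>)" for k
  have "(\<Sum>k=0..m. caputo_coeff \<alpha> n k) = d m" for m
    by (induction m) (auto simp: caputo_coeff_def d_def algebra_simps)
  then show ?thesis
    by (simp add: d_def)
qed

lemma caputo_coeff_diag_ge:
  assumes "0 < \<alpha>" "\<alpha> < 1"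
  shows "2 - 2 powr (1 - \<alpha>) \<le> caputo_coeff \<alpha> n n"
proof -
  \<comment> \<open>For \<open>n > 0\<close> the claim is an equality; this covers
    \<open>n = 0\<close>, where the coefficient is 1.\<close>
  have "1 \<le> (2::real) powr (1 - \<alpha>)"
    using assms by (intro ge_one_powr_ge_zero) auto
  then show ?thesis
    by (simp add: caputo_coeff_def)
qed

text \<open>\<open>ln \<circ> Gamma\<close> is convex and vanishes at 1 and 2, so between them it
  lies below the zero chord.\<close>

lemma Gamma_le_1:
  fixes x :: real
  assumes "1 \<le> x" "x \<le> 2"
  shows "Gamma x \<le> 1"
proof -
  have "convex_on {1..2} (ln \<circ> Gamma :: real \<Rightarrow> real)"
    by (rule convex_on_subset[OF log_convex_Gamma_real]) auto
  from convex_onD_Icc'[OF this, of x] have "ln (Gamma x) \<le> 0"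
    using assms Gamma_fact[of 1, where 'a = real] by simp
  then show ?thesis
    using Gamma_real_pos[of x] assms by simp
qed

section \<open>Infinite sums and total variation in [0, \<infinity>]\<close>

text \<open>Multiplication by a finite constant is additive and continuous on
  \<open>ennreal\<close>, so it commutes with the limit of finite sums.\<close>

lemma infsum_cmult_ennreal:
  fixes f :: "'a \<Rightarrow> ennreal"
  assumes "c < top"
  shows "(\<Sum>\<^sub>\<infinity>x\<in>A. c * f x) = c * (\<Sum>\<^sub>\<infinity>x\<in>A. f x)"
proof -
  have "infsum ((*) c \<circ> f) A = c * infsum f A"
  proof (rule infsum_comm_additive_general)
    have "continuous_on UNIV (\<lambda>x. c * x)"
      using assms by (intro ennreal_continuous_on_cmult continuous_on_id)
    then show "isCont ((*) c) (infsum f A)"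
      by (simp add: continuous_on_eq_continuous_at)
  qed (auto simp: sum_distrib_left nonneg_summable_on_complete)
  then show ?thesis
    by (simp add: o_def)
qed

lemma infsum_int_shift:
  fixes f :: "int \<Rightarrow> 'b :: {comm_monoid_add, t2_space}"
  shows "(\<Sum>\<^sub>\<infinity>j\<in>UNIV. f (j + i)) = (\<Sum>\<^sub>\<infinity>j\<in>UNIV. f j)"
  by (rule infsum_reindex_bij_betw) (rule bij_betw_byWitness[where f' = "\<lambda>j. j - i"], auto)

lemma total_variation_add:
  "total_variation (\<lambda>j. u j + w j) \<le> total_variation u + total_variation w"
proof -
  have "total_variation (\<lambda>j. u j + w j)
      \<le> (\<Sum>\<^sub>\<infinity>j\<in>UNIV. ennreal \<bar>u (j + 1) - u j\<bar> + ennreal \<bar>w (j + 1) - w j\<bar>)"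
    unfolding total_variation_def
    by (intro infsum_mono nonneg_summable_on_complete) (auto simp flip: ennreal_plus intro!: ennreal_leI)
  then show ?thesis
    by (simp add: infsum_add nonneg_summable_on_complete total_variation_def)
qed

lemma total_variation_cmult:
  assumes "0 \<le> c"
  shows "total_variation (\<lambda>j. c * u j) = ennreal c * total_variation u"
  unfolding total_variation_def
  by (subst infsum_cmult_ennreal[symmetric])
     (use assms in \<open>auto simp: abs_mult ennreal_mult simp flip: right_diff_distrib\<close>)

lemma total_variation_sum:
  assumes "finite K"
  shows "total_variation (\<lambda>j. \<Sum>k\<in>K. u k j) \<le> (\<Sum>k\<in>K. total_variation (u k))"
  using assms
proof (induction K)
  case empty
  then show ?case by (simp add: total_variation_def)
next
  case (insert x K)
  then show ?case
    using total_variation_add[of "u x" "\<lambda>j. \<Sum>k\<in>K. u k j"]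
    by (auto intro: order_trans add_left_mono)
qed

text \<open>Harten's argument: the mass that the step moves across an edge is gained by the neighbouring
  edge, so it cancels in the sum over all edges.\<close>

lemma total_variation_upwind_step:
  fixes u p q :: "int \<Rightarrow> real"
  assumes p: "\<And>j. 0 \<le> p j" and q: "\<And>j. 0 \<le> q j" and c: "\<And>j. p j + q j \<le> c"
  shows "total_variation (\<lambda>j. c * u j - p (j - 1) * (u j - u (j - 1)) + q j * (u (j + 1) - u j))
      \<le> ennreal c * total_variation u"
proof -
  define v where "v j = u (j + 1) - u j" for j
  define d where "d j = ennreal ((c - p j - q j) * \<bar>v j\<bar>)" for j
  define P where "P j = ennreal (p j * \<bar>v j\<bar>)" for j
  define Q where "Q j = ennreal (q j * \<bar>v j\<bar>)" for j
  have c0: "0 \<le> c"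
    using p[of 0] q[of 0] c[of 0] by simp
  let ?w = "\<lambda>j. c * u j - p (j - 1) * (u j - u (j - 1)) + q j * (u (j + 1) - u j)"
  \<comment> \<open>Writing the left neighbour as \<open>j + (-1)\<close> gives both shifts the
    shape of \<open>infsum_int_shift\<close>.\<close>
  have le: "ennreal \<bar>?w (j + 1) - ?w j\<bar> \<le> d j + P (j + (-1)) + Q (j + 1)" for j
  proof -
    have "?w (j + 1) - ?w j = (c - p j - q j) * v j + p (j - 1) * v (j - 1) + q (j + 1) * v (j + 1)"
      by (simp add: v_def algebra_simps)
    also have "\<bar>\<dots>\<bar> \<le> \<bar>(c - p j - q j) * v j\<bar> + \<bar>p (j - 1) * v (j - 1)\<bar> + \<bar>q (j + 1) * v (j + 1)\<bar>"
      by linarith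
    also have "\<dots> = (c - p j - q j) * \<bar>v j\<bar> + p (j - 1) * \<bar>v (j - 1)\<bar> + q (j + 1) * \<bar>v (j + 1)\<bar>"
      using p[of "j - 1"] q[of "j + 1"] c[of j] by (simp add: abs_mult)
    finally show ?thesis
      using p[of "j - 1"] q[of "j + 1"] c[of j]
      by (simp add: d_def P_def Q_def ennreal_leI flip: ennreal_plus)
  qed
  have "total_variation ?w \<le> (\<Sum>\<^sub>\<infinity>j\<in>UNIV. d j + P (j + (-1)) + Q (j + 1))"
    unfolding total_variation_def using le by (intro infsum_mono nonneg_summable_on_complete) auto
  also have "\<dots> = infsum d UNIV + infsum P UNIV + infsum Q UNIV"
    by (simp only: infsum_add infsum_int_shift nonneg_summable_on_complete zero_le)
  also have "\<dots> = (\<Sum>\<^sub>\<infinity>j\<in>UNIV. d j + P j + Q j)"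
    by (simp add: infsum_add nonneg_summable_on_complete)
  also have "\<dots> = (\<Sum>\<^sub>\<infinity>j\<in>UNIV. ennreal c * ennreal \<bar>v j\<bar>)"
  proof (rule infsum_cong)
    fix j
    have "0 \<le> c - p j - q j"
      using c[of j] by simp
    then have "d j + P j + Q j = ennreal ((c - p j - q j) * \<bar>v j\<bar> + p j * \<bar>v j\<bar> + q j * \<bar>v j\<bar>)"
      using p[of j] q[of j] by (simp add: d_def P_def Q_def flip: ennreal_plus)
    also have "\<dots> = ennreal (c * \<bar>v j\<bar>)"
      by (simp add: algebra_simps)
    finally show "d j + P j + Q j = ennreal c * ennreal \<bar>v j\<bar>"
      using c0 by (simp add: ennreal_mult)
  qed
  also have "\<dots> = ennreal c * total_variation u"
    by (simp add: infsum_cmult_ennreal total_variation_def v_def)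
  finally show ?thesis .
qed

section \<open>Convexity of the upwind step and slopes of monotone fluxes\<close>

text \<open>The weights \<open>p / c\<close>, \<open>(c - p - q) / c\<close> and
  \<open>q / c\<close> are nonnegative with sum 1. The factor \<open>c\<close> stays with
  \<open>w\<close>, which later replaces \<open>y\<close> under the weight \<open>c\<close> in a
  longer convex combination.\<close>

lemma convex_upwind_step:
  fixes x y z c p q :: real
  assumes "convex I" "x \<in> I" "y \<in> I" "z \<in> I"
    and "0 \<le> p" "0 \<le> q" "p + q \<le> c" "0 < c"
  shows "\<exists>w\<in>I. c * w = c * y - p * (y - x) + q * (z - y)"
proof
  let ?w = "(p / c) *\<^sub>R x + ((c - p - q) / c) *\<^sub>R y + (q / c) *\<^sub>R z"
  show "?w \<in> I"
    using convex_sum[of "{0, 1, 2}" I "\<lambda>i. if i = 0 then p / c else if i = 1 then (c - p - q) / c else q / c"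
        "\<lambda>i::nat. if i = 0 then x else if i = 1 then y else z"] assms
    by (simp add: add.assoc flip: add_divide_distrib)
  show "c * ?w = c * y - p * (y - x) + q * (z - y)"
    using assms by (simp add: field_simps)
qed

text \<open>The mean value theorem applies, its intermediate point lying in the interval
  \<open>I\<close>. This supplies the coefficients for Harten's argument, even for
  \<open>x = y\<close>, where the quotient is undefined.\<close>

lemma monotone_difference_quotient:
  fixes g :: "real \<Rightarrow> real"
  assumes der: "\<And>x. (g has_real_derivative g' x) (at x)"
    and bound: "\<And>x. x \<in> I \<Longrightarrow> 0 \<le> g' x \<and> g' x \<le> L"
    and I: "is_interval I" "x \<in> I" "y \<in> I"
  shows "\<exists>s. 0 \<le> s \<and> s \<le> L \<and> g y - g x = s * (y - x)"
proof -
  have *: "\<exists>s. 0 \<le> s \<and> s \<le> L \<and> g b - g a = s * (b - a)" if "a < b" "a \<in> I" "b \<in> I" for a b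
  proof -
    obtain z where "a < z" "z < b" "g b - g a = (b - a) * g' z"
      using MVT2[OF \<open>a < b\<close> der] by auto
    moreover from this have "z \<in> I"
      using I(1) that unfolding is_interval_1 by (meson less_imp_le)
    ultimately show ?thesis
      using bound by (metis mult.commute)
  qed
  show ?thesis
  proof (cases x y rule: linorder_cases)
    case less
    then show ?thesis using * I by blast
  next
    case equal
    then show ?thesis using bound[OF I(2)] by (intro exI[of _ "g' x"]) auto
  next
    case greater
    then obtain s where "0 \<le> s" "s \<le> L" "g x - g y = s * (x - y)" using * I by blast
    then show ?thesis by (intro exI[of _ s]) (auto simp: algebra_simps)
  qed
qed

section \<open>The CFL condition in real terms and the scheme solved for the new level\<close>

text \<open>The CFL condition divides by \<open>Gamma (2 - \<alpha>)\<close>, whereas the solved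
  scheme multiplies by it; the latter factor is no larger since
  \<open>Gamma (2 - \<alpha>) \<le> 1\<close>.\<close>

lemma cfl_condition_bounds:
  assumes cfl: "cfl_condition \<alpha> \<tau> h fp fm I"
    and "0 < \<alpha>" "\<alpha> < 1" "0 < \<tau>" "0 < h" "I \<noteq> {}"
  obtains A B where "\<And>x. x \<in> I \<Longrightarrow> \<bar>deriv fp x\<bar> \<le> A" "\<And>x. x \<in> I \<Longrightarrow> \<bar>deriv fm x\<bar> \<le> B"
    "Gamma (2 - \<alpha>) * \<tau> powr \<alpha> / h * (A + B) \<le> 2 - 2 powr (1 - \<alpha>)"
proof -
  let ?S = "SUP x\<in>I. ennreal \<bar>deriv fp x\<bar>" and ?T = "SUP x\<in>I. ennreal \<bar>deriv fm x\<bar>"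
  let ?l = "\<tau> powr \<alpha> / (h * Gamma (2 - \<alpha>))" and ?c = "2 - 2 powr (1 - \<alpha>)"
  have G: "0 < Gamma (2 - \<alpha>)" "Gamma (2 - \<alpha>) \<le> 1"
    using assms by (auto intro!: Gamma_real_pos Gamma_le_1)
  have l: "0 < ?l"
    using assms G by simp
  have cfl': "ennreal ?l * (?S + ?T) \<le> ennreal ?c"
    using cfl unfolding cfl_condition_def .
  \<comment> \<open>A finite product with a positive factor forces both suprema to be finite, hence
    real.\<close>
  then have "ennreal ?l * (?S + ?T) < top"
    by (rule le_less_trans) simp
  then have "?S + ?T < top"
    using l by (auto simp: ennreal_mult_less_top)
  then obtain A B where A: "?S = ennreal A" "0 \<le> A" and B: "?T = ennreal B" "0 \<le> B"
    by (cases ?S; cases ?T) auto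
  \<comment> \<open>The sign matters for returning to the reals, because \<open>ennreal\<close>
    sends negative numbers to 0.\<close>
  have c: "0 \<le> ?c"
    using powr_mono[of "1 - \<alpha>" 1 2] assms by simp
  have "?l * (A + B) \<le> ?c"
    using cfl' l A(2) B(2) c unfolding A(1) B(1)
    by (simp add: ennreal_le_iff flip: ennreal_plus ennreal_mult)
  moreover have "Gamma (2 - \<alpha>) * \<tau> powr \<alpha> / h \<le> ?l"
  proof -
    have "Gamma (2 - \<alpha>) * Gamma (2 - \<alpha>) \<le> 1"
      using G by (intro mult_le_one) auto
    then have "Gamma (2 - \<alpha>) * Gamma (2 - \<alpha>) * \<tau> powr \<alpha> \<le> 1 * \<tau> powr \<alpha>"
      by (intro mult_right_mono) auto
    then show ?thesis
      using assms G by (simp add: field_simps)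
  qed
  ultimately have "Gamma (2 - \<alpha>) * \<tau> powr \<alpha> / h * (A + B) \<le> ?c"
    using A(2) B(2) by (meson add_nonneg_nonneg mult_right_mono order_trans)
  moreover have "\<bar>deriv fp x\<bar> \<le> A" if "x \<in> I" for x
    using SUP_upper[OF that, of "\<lambda>x. ennreal \<bar>deriv fp x\<bar>"] A by simp
  moreover have "\<bar>deriv fm x\<bar> \<le> B" if "x \<in> I" for x
    using SUP_upper[OF that, of "\<lambda>x. ennreal \<bar>deriv fm x\<bar>"] B by simp
  ultimately show thesis
    using that by blast
qed

text \<open>The term \<open>k = n\<close> is split off from the history because it has to absorb the
  flux differences, which involve level \<open>n\<close> only.\<close>

lemma upwind_solution_step:
  assumes "upwind_solution \<alpha> \<tau> h fp fm U" "\<alpha> < 1" "0 < \<tau>" "0 < h"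
  shows "U (Suc n) j = (\<Sum>k<n. caputo_coeff \<alpha> n k * U k j)
    + (caputo_coeff \<alpha> n n * U n j
       - Gamma (2 - \<alpha>) * \<tau> powr \<alpha> / h * (fp (U n j) - fp (U n (j - 1)))
       - Gamma (2 - \<alpha>) * \<tau> powr \<alpha> / h * (fm (U n (j + 1)) - fm (U n j)))"
proof -
  let ?G = "Gamma (2 - \<alpha>) * \<tau> powr \<alpha>"
  have G: "0 < ?G"
    using assms by (auto intro!: mult_pos_pos Gamma_real_pos)
  have solve: "X = - (g / h * Y + g / h * Z)" if "1 / g * X + 1 / h * Y + 1 / h * Z = 0" "g \<noteq> 0"
    for g X Y Z :: real
  proof -
    have "X + g / h * Y + g / h * Z = g * (1 / g * X + 1 / h * Y + 1 / h * Z)"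
      using that(2) by (simp add: distrib_left)
    then show ?thesis
      using that(1) by simp
  qed
  have "1 / ?G * (U (Suc n) j - (\<Sum>k=0..n. caputo_coeff \<alpha> n k * U k j))
      + 1 / h * (fp (U n j) - fp (U n (j - 1))) + 1 / h * (fm (U n (j + 1)) - fm (U n j)) = 0"
    using assms(1) unfolding upwind_solution_def discrete_caputo_def by simp
  then have "U (Suc n) j - (\<Sum>k=0..n. caputo_coeff \<alpha> n k * U k j)
      = - (?G / h * (fp (U n j) - fp (U n (j - 1))) + ?G / h * (fm (U n (j + 1)) - fm (U n j)))"
    by (rule solve) (use G in auto)
  moreover have "(\<Sum>k=0..n. caputo_coeff \<alpha> n k * U k j)
      = (\<Sum>k<n. caputo_coeff \<alpha> n k * U k j) + caputo_coeff \<alpha> n n * U n j"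
    by (simp add: atLeast0AtMost flip: lessThan_Suc_atMost)
  ultimately show ?thesis
    by simp
qed

section \<open>Induction over the time levels\<close>

theorem corollary3p1:
  fixes \<alpha> \<tau> h :: real
    and f fp fm :: "real \<Rightarrow> real"
    and U :: "nat \<Rightarrow> int \<Rightarrow> real"
    and I :: "real set"
  assumes "0 < \<alpha>" and "\<alpha> < 1"
    and "0 < \<tau>" and "0 < h"
    and "\<And>x. f x = fp x + fm x"
    and "fp C1_differentiable_on UNIV" and "fm C1_differentiable_on UNIV"
    and "\<And>x. 0 \<le> deriv fp x" and "\<And>x. deriv fm x \<le> 0"
    and "upwind_solution \<alpha> \<tau> h fp fm U"
    and "is_interval I" and "\<And>j. U 0 j \<in> I"
    and "cfl_condition \<alpha> \<tau> h fp fm I"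
  shows "\<forall>n\<ge>1. total_variation (U n) \<le> total_variation (U 0)"
proof -
  note ab = \<open>0 < \<alpha>\<close> \<open>\<alpha> < 1\<close>
  define l where "l = Gamma (2 - \<alpha>) * \<tau> powr \<alpha> / h"
  define c where "c = caputo_coeff \<alpha>"
  have l: "0 < l"
    using assms(1-4) by (auto simp: l_def intro!: divide_pos_pos mult_pos_pos Gamma_real_pos)
  obtain A B where A: "\<And>x. x \<in> I \<Longrightarrow> \<bar>deriv fp x\<bar> \<le> A" and B: "\<And>x. x \<in> I \<Longrightarrow> \<bar>deriv fm x\<bar> \<le> B"
    and AB: "l * (A + B) \<le> 2 - 2 powr (1 - \<alpha>)"
    using cfl_condition_bounds[OF assms(13) assms(1-4)] assms(12) unfolding l_def by blast
  have c_nonneg: "0 \<le> c n k" if "k \<le> n" for n k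
    unfolding c_def by (rule caputo_coeff_nonneg[OF ab that])
  have c_sum: "(\<Sum>k<n. c n k) + c n n = 1" for n
    using sum_caputo_coeff[OF ab(2), of n]
    by (simp add: c_def atLeast0AtMost flip: lessThan_Suc_atMost)
  have c_ge: "2 - 2 powr (1 - \<alpha>) \<le> c n n" for n
    unfolding c_def by (rule caputo_coeff_diag_ge[OF ab])
  \<comment> \<open>Strictness makes the diagonal weight positive, so that
    \<open>convex_upwind_step\<close> can divide by it.\<close>
  have "(2::real) powr (1 - \<alpha>) < 2 powr 1"
    using ab by (intro powr_less_mono) auto
  then have c_pos: "0 < c n n" for n
    using c_ge[of n] by simp
  \<comment> \<open>With \<open>fm\<close> negated both functions are nondecreasing, and one slope
    lemma serves for both.\<close>
  have dp: "(fp has_real_derivative deriv fp x) (at x)"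
    and dm: "((\<lambda>x. - fm x) has_real_derivative - deriv fm x) (at x)" for x
    using assms(6,7)
    by (auto simp: C1_differentiable_on_eq DERIV_deriv_iff_real_differentiable intro!: DERIV_minus)
  define w where "w n j = c n n * U n j - l * (fp (U n j) - fp (U n (j - 1)))
       - l * (fm (U n (j + 1)) - fm (U n j))" for n j
  have step: "U (Suc n) j = (\<Sum>k<n. c n k * U k j) + w n j" for n j
    unfolding w_def c_def l_def by (rule upwind_solution_step[OF assms(10) assms(2-4)])
  \<comment> \<open>The bound is for independent \<open>i\<close> and \<open>j\<close>: the
    variation estimate pairs \<open>p j\<close> with \<open>q j\<close>, the convex combination
    pairs \<open>p (j - 1)\<close> with \<open>q j\<close>.\<close>
  have w_upwind: "\<exists>p q. (\<forall>j. 0 \<le> p j) \<and> (\<forall>j. 0 \<le> q j) \<and> (\<forall>i j. p i + q j \<le> c n n) \<and>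
      w n = (\<lambda>j. c n n * U n j - p (j - 1) * (U n j - U n (j - 1)) + q j * (U n (j + 1) - U n j))"
    if U: "\<And>j. U n j \<in> I" for n
  proof -
    have "\<forall>j. \<exists>s. 0 \<le> s \<and> s \<le> A \<and> fp (U n (j + 1)) - fp (U n j) = s * (U n (j + 1) - U n j)"
      using monotone_difference_quotient[OF dp _ assms(11) U U] A assms(8) by (simp add: abs_le_iff)
    then obtain p where p: "\<And>j. 0 \<le> p j" "\<And>j. p j \<le> A"
      "\<And>j. fp (U n (j + 1)) - fp (U n j) = p j * (U n (j + 1) - U n j)" by metis
    have "\<forall>j. \<exists>s. 0 \<le> s \<and> s \<le> B \<and> - fm (U n (j + 1)) - - fm (U n j) = s * (U n (j + 1) - U n j)"
      using monotone_difference_quotient[OF dm _ assms(11) U U] B assms(9) by (simp add: abs_le_iff)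
    then obtain q where q: "\<And>j. 0 \<le> q j" "\<And>j. q j \<le> B"
      "\<And>j. - fm (U n (j + 1)) - - fm (U n j) = q j * (U n (j + 1) - U n j)" by metis
    have "l * p i + l * q j \<le> c n n" for i j
    proof -
      have "l * (p i + q j) \<le> l * (A + B)"
        using p(2)[of i] q(2)[of j] l by (intro mult_left_mono) auto
      then show ?thesis
        using AB c_ge[of n] by (simp add: distrib_left)
    qed
    moreover have "w n j = c n n * U n j - l * p (j - 1) * (U n j - U n (j - 1))
        + l * q j * (U n (j + 1) - U n j)" for j
    proof -
      have "fp (U n j) - fp (U n (j - 1)) = p (j - 1) * (U n j - U n (j - 1))"
        using p(3)[of "j - 1"] by simp
      moreover have "fm (U n (j + 1)) - fm (U n j) = - (q j * (U n (j + 1) - U n j))"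
        using q(3)[of j] by simp
      ultimately show ?thesis
        by (simp add: w_def)
    qed
    ultimately show ?thesis
      using p(1) q(1) l by (intro exI[of _ "\<lambda>j. l * p j"] exI[of _ "\<lambda>j. l * q j"]) auto
  qed
  \<comment> \<open>Strong induction, since the memory term reaches all earlier levels. Membership
    in \<open>I\<close> is carried along because \<open>w_upwind\<close> requires it.\<close>
  have "(\<forall>j. U n j \<in> I) \<and> total_variation (U n) \<le> total_variation (U 0)" for n
  proof (induction n rule: less_induct)
    case (less m)
    show ?case
    proof (cases m)
      case 0
      then show ?thesis using assms(12) by simp
    next
      case (Suc n)
      then have U: "U k j \<in> I" and TV: "total_variation (U k) \<le> total_variation (U 0)"
        if "k \<le> n" for k j
        using less that by auto
      obtain p q where p: "\<And>j. 0 \<le> p j" and q: "\<And>j. 0 \<le> q j" and pq: "\<And>i j. p i + q j \<le> c n n"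
        and w: "w n = (\<lambda>j. c n n * U n j - p (j - 1) * (U n j - U n (j - 1))
          + q j * (U n (j + 1) - U n j))"
        using w_upwind[of n] U[of n] by blast
      have "U (Suc n) j \<in> I" for j
      proof -
        obtain z where z: "z \<in> I" "c n n * z = w n j"
          using convex_upwind_step[of I "U n (j - 1)" "U n j" "U n (j + 1)" "p (j - 1)" "q j" "c n n"]
            is_interval_convex[OF assms(11)] U[of n] p q pq c_pos[of n] unfolding w by auto
        \<comment> \<open>Putting \<open>z\<close> in place of \<open>U n j\<close> hides the flux
          terms and leaves a combination with the weights \<open>c n k\<close>, whose sum is
          1.\<close>
        have "(\<Sum>k\<in>{..n}. c n k *\<^sub>R (if k < n then U k j else z)) \<in> I"
          using c_sum[of n] c_nonneg U z is_interval_convex[OF assms(11)]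
          by (intro convex_sum) (auto simp flip: lessThan_Suc_atMost)
        then show ?thesis
          by (simp add: step z flip: lessThan_Suc_atMost)
      qed
      moreover have "total_variation (U (Suc n)) \<le> total_variation (U 0)"
      proof -
        have "total_variation (U (Suc n)) = total_variation (\<lambda>j. (\<Sum>k<n. c n k * U k j) + w n j)"
          by (rule arg_cong[where f = total_variation]) (use step in auto)
        also have "\<dots> \<le> (\<Sum>k<n. total_variation (\<lambda>j. c n k * U k j)) + total_variation (w n)"
          by (intro order_trans[OF total_variation_add] add_right_mono total_variation_sum) simp
        also have "\<dots> \<le> (\<Sum>k<n. ennreal (c n k) * total_variation (U k))
            + ennreal (c n n) * total_variation (U n)"
          unfolding w using p q pq c_nonneg
          by (intro add_mono sum_mono total_variation_upwind_step) (auto simp: total_variation_cmult)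
        also have "\<dots> \<le> (\<Sum>k<n. ennreal (c n k) * total_variation (U 0))
            + ennreal (c n n) * total_variation (U 0)"
          using TV by (intro add_mono sum_mono mult_left_mono) auto
        also have "\<dots> = ennreal ((\<Sum>k<n. c n k) + c n n) * total_variation (U 0)"
        proof -
          \<comment> \<open>Nonnegative weights let \<open>ennreal\<close> pass through the
            sums.\<close>
          have "ennreal ((\<Sum>k<n. c n k) + c n n) = (\<Sum>k<n. ennreal (c n k)) + ennreal (c n n)"
            using c_nonneg by (subst ennreal_plus) (auto intro!: sum_nonneg sum_ennreal[symmetric])
          then show ?thesis
            by (simp add: distrib_right sum_distrib_right)
        qed
        also have "\<dots> = total_variation (U 0)"
          by (simp add: c_sum)
        finally show ?thesis .
      qed
      ultimately show ?thesis using Suc by simp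
    qed
  qed
  then show ?thesis
    by blast
qed

end
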